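(* Let $\varphi_S(z)=1+\sin z$ and $\varphi_B(z)=\exp(e^z-1)$ for $z\in\mathbb D$. Then the sharp $\mathcal S^*(\varphi_B)$-radius of $\mathcal S^*(\varphi_S)$ is $$R_{\mathcal S^*(\varphi_B)}(\mathcal S^*(\varphi_S))=\arcsin\bigl(1-e^{1/e-1}\bigr),$$ where the exponent is $\tfrac1e-1$.
   Context: Let $\mathbb D=\{z\in\mathbb C:|z|<1\}$ and let $\mathcal A$ be the class of functions $f$ analytic on $\mathbb D$ with $f(0)=0$ and $f'(0)=1$. For an analytic function $\varphi$ on $\mathbb D$ with $\varphi(0)=1$, the class $\mathcal S^*(\varphi)$ consists of all $f\in\mathcal A$ with $zf'(z)/f(z)\prec\varphi(z)$; that is, there is an analytic $\omega:\mathbb D\to\mathbb D$ with $\omega(0)=0$ such that $zf'(z)/f(z)=\varphi(\omega(z))$ on $\mathbb D$ (the quotient takes the value $1$ at $z=0$, and $f$ has no other zeros). For two such functions $\varphi_1,\varphi_2$, the sharp $\mathcal S^*(\varphi_2)$-radius of $\mathcal S^*(\varphi_1)$ is $$R_{\mathcal S^*(\varphi_2)}(\mathcal S^*(\varphi_1))=\sup\left\{r\in(0,1]: f_r(z)=\tfrac{f(rz)}{r}\text{ belongs to }\mathcal S^*(\varphi_2)\text{ for every } f\in\mathcal S^*(\varphi_1)\right\}.$$ *)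

theory Defs
  imports "HOL-Analysis.Analysis"
begin

abbreviation unit_disc :: "complex set" where
  "unit_disc \<equiv> ball 0 1"

text \<open>Functions on the disc are total functions on \<^typ>\<open>complex\<close>; every definition below
  depends only on their values on \<^term>\<open>unit_disc\<close>.\<close>

definition normalized_analytic :: "(complex \<Rightarrow> complex) set" where
  "normalized_analytic = {f. f holomorphic_on unit_disc \<and> f 0 = 0 \<and> deriv f 0 = 1}"

text \<open>The pointwise form of subordination: \<open>g = \<phi> \<circ> \<omega>\<close> on the disc for some Schwarz
  function \<open>\<omega>\<close>.\<close>

definition subordinate :: "(complex \<Rightarrow> complex) \<Rightarrow> (complex \<Rightarrow> complex) \<Rightarrow> bool" where
  "subordinate g \<phi> \<longleftrightarrow>
     (\<exists>\<omega>. \<omega> holomorphic_on unit_disc \<and> \<omega> ` unit_disc \<subseteq> unit_disc \<and> \<omega> 0 = 0 \<and>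
          (\<forall>z\<in>unit_disc. g z = \<phi> (\<omega> z)))"

text \<open>The quotient \<open>z f'(z) / f(z)\<close> with its removable singularity at \<open>0\<close> filled in
  (for \<open>f 0 = 0\<close>, \<open>f' 0 = 1\<close>).\<close>

definition log_deriv_quotient :: "(complex \<Rightarrow> complex) \<Rightarrow> complex \<Rightarrow> complex" where
  "log_deriv_quotient f z = (if z = 0 then 1 else z * deriv f z / f z)"

text \<open>Since \<open>x / 0 = 0\<close>, the absence of zeros of \<open>f\<close> other than the origin has to be required
  explicitly.\<close>

definition starlike_class :: "(complex \<Rightarrow> complex) \<Rightarrow> (complex \<Rightarrow> complex) set" where
  "starlike_class \<phi> =
     {f \<in> normalized_analytic.
        (\<forall>z\<in>unit_disc - {0}. f z \<noteq> 0) \<and> subordinate (log_deriv_quotient f) \<phi>}"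

definition dilation :: "real \<Rightarrow> (complex \<Rightarrow> complex) \<Rightarrow> complex \<Rightarrow> complex" where
  "dilation r f z = f (of_real r * z) / of_real r"

text \<open>\<open>starlike_radius \<phi>\<^sub>2 \<phi>\<^sub>1\<close> is the sharp \<open>S\<^sup>*(\<phi>\<^sub>2)\<close>-radius of \<open>S\<^sup>*(\<phi>\<^sub>1)\<close>.\<close>

definition starlike_radius :: "(complex \<Rightarrow> complex) \<Rightarrow> (complex \<Rightarrow> complex) \<Rightarrow> real" where
  "starlike_radius \<phi>\<^sub>2 \<phi>\<^sub>1 =
     Sup {r \<in> {0<..1}. \<forall>f\<in>starlike_class \<phi>\<^sub>1. dilation r f \<in> starlike_class \<phi>\<^sub>2}"

definition phi_S :: "complex \<Rightarrow> complex" where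
  "phi_S z = 1 + sin z"

definition phi_B :: "complex \<Rightarrow> complex" where
  "phi_B z = exp (exp z - 1)"

end

theory Submission
  imports Defs "HOL-Complex_Analysis.Complex_Analysis"
begin

text \<open>On the disc of radius \<open>R\<close> the inclusion of the range of \<open>phi_S\<close> in that of \<open>phi_B\<close> means that
  \<open>\<omega> z = ln (1 + ln (1 + sin z))\<close> is bounded by \<open>1\<close>. Both \<open>M z = - ln (1 - sin z)\<close> and
  \<open>- ln (1 - u)\<close> are dominated by their values at \<open>\<bar>z\<bar>\<close> and \<open>\<bar>u\<bar>\<close>, because their derivatives are; for
  \<open>M' z = cos z / (1 - sin z)\<close> the square of the modulus at \<open>a + \<i> b\<close> is
  \<open>(cosh b + sin a) / (cosh b - sin a)\<close>. Hence \<open>\<bar>\<omega> z\<bar> \<le> - \<omega> (- \<bar>z\<bar>)\<close>, which is less than \<open>1\<close> exactly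
  for \<open>\<bar>z\<bar> < R\<close>. Conversely, \<open>phi_B\<close> omits the real numbers between \<open>0\<close> and \<open>phi_B (- 1)\<close> on the
  disc, while the function with \<open>z f' / f = phi_S\<close> attains them.\<close>

section \<open>Comparison of the logarithms with real majorants\<close>

lemma norm_diff_le_of_deriv_majorant:
  fixes f f' :: "complex \<Rightarrow> complex" and g g' :: "real \<Rightarrow> real"
  assumes f: "\<And>w. norm w < r \<Longrightarrow> (f has_field_derivative f' w) (at w)"
    and g: "\<And>t. 0 \<le> t \<Longrightarrow> t < r \<Longrightarrow> (g has_real_derivative g' t) (at t)"
    and bound: "\<And>w. norm w < r \<Longrightarrow> norm (f' w) \<le> g' (norm w)"
    and z: "norm z < r"
  shows "norm (f z - f 0) \<le> g (norm z) - g 0"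
proof (cases "z = 0")
  case False
  \<comment> \<open>Along the ray through \<open>z\<close> with unit direction \<open>u\<close>, the
    claim becomes the mean value inequality on the real interval from 0 to
    \<open>norm z\<close>.\<close>
  define u where "u = sgn z"
  have u: "norm u = 1" "of_real (norm z) * u = z"
    using False by (simp_all add: u_def sgn_eq norm_divide)
  have in_disc: "norm (of_real t * u) < r" if "0 \<le> t" "t \<le> norm z" for t
    using that z u by (simp add: norm_mult)
  have f_deriv: "((\<lambda>t. f (of_real t * u)) has_vector_derivative f' (of_real t * u) * u) (at t)"
    if "0 \<le> t" "t \<le> norm z" for t
  proof -
    have "((\<lambda>t. of_real t * u) has_vector_derivative u) (at t)"
      by (auto intro!: derivative_eq_intros has_vector_derivative_real_field)
    from field_vector_diff_chain_at[where f = "\<lambda>t. of_real t * u", OF this f[OF in_disc[OF that]]]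
    show ?thesis by (simp add: o_def mult.commute)
  qed
  have g_deriv: "(g has_vector_derivative g' t) (at t)" if "0 \<le> t" "t \<le> norm z" for t
    using g[of t] that z by (simp add: has_real_derivative_iff_has_vector_derivative)
  have "norm (f (of_real (norm z) * u) - f (of_real 0 * u)) \<le> g (norm z) - g 0"
  proof (rule differentiable_bound_general
      [where f' = "\<lambda>t. f' (of_real t * u) * u" and \<phi>' = g'])
    show "continuous_on {0..norm z} (\<lambda>t. f (of_real t * u))"
      by (intro continuous_at_imp_continuous_on ballI)
        (use f_deriv in \<open>auto intro: has_vector_derivative_continuous\<close>)
    show "continuous_on {0..norm z} g"
      by (intro continuous_at_imp_continuous_on ballI)
        (use g_deriv in \<open>auto intro: has_vector_derivative_continuous\<close>)
    show "norm (f' (of_real t * u) * u) \<le> g' t" if "0 < t" "t < norm z" for t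
      using bound[OF in_disc[of t]] that u by (simp add: norm_mult)
  qed (use False f_deriv g_deriv in auto)
  then show ?thesis using u by simp
qed auto

text \<open>The squared modulus (C + sin a) / (C - sin a) is increasing in the ratio sin a / C. This
  ratio is at most s = sin |z|, and (1 + s) / (1 - s) is the square of the right-hand side.\<close>

lemma norm_cos_div_one_minus_sin_le:
  fixes z :: complex
  assumes z: "norm z < pi / 2"
  shows "norm (cos z / (1 - sin z)) \<le> cos (norm z) / (1 - sin (norm z))"
proof -
  define a C S where "a = Re z" and "C = cosh (Im z)" and "S = sinh (Im z)"
  define s where "s = sin (norm z)"
  have a: "\<bar>a\<bar> \<le> norm z" by (simp add: a_def abs_Re_le_cmod)
  have hyp: "C\<^sup>2 = 1 + S\<^sup>2" using cosh_square_eq[of "Im z"] by (simp add: C_def S_def)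
  have C: "C \<ge> 1" by (simp add: C_def cosh_real_ge_1)
  have trig: "(cos a)\<^sup>2 = 1 - (sin a)\<^sup>2" by (rule cos_squared_eq)
  have re_im: "Re (sin z) = sin a * C" "Im (sin z) = cos a * S"
    "Re (cos z) = cos a * C" "Im (cos z) = - (sin a * S)"
    by (simp_all add: Re_sin Im_sin Re_cos Im_cos a_def C_def S_def cosh_field_def sinh_field_def
        field_simps)
  have cos_sq: "(norm (cos z))\<^sup>2 = (C + sin a) * (C - sin a)"
    unfolding cmod_power2 re_im using hyp trig by algebra
  have sin_sq: "(norm (1 - sin z))\<^sup>2 = (C - sin a)\<^sup>2"
    unfolding cmod_power2 using re_im hyp trig by simp algebra
  have sa: "sin a \<le> s"
    unfolding s_def by (rule sin_monotone_2pi_le) (use a z in auto)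
  have s0: "0 \<le> s" unfolding s_def using z pi_gt_zero by (intro sin_ge_zero norm_ge_zero) linarith
  have s1: "s < 1" unfolding s_def using sin_monotone_2pi[of "norm z" "pi / 2"] z pi_gt_zero norm_ge_zero[of z]
    by simp
  have c: "cos (norm z) > 0" using z pi_gt_zero norm_ge_zero[of z] by (intro cos_gt_zero_pi) linarith+
  have sC: "sin a < C" using sa s1 C by linarith
  have n1: "norm (1 - sin z) = C - sin a"
    using sin_sq sC by (simp add: power2_eq_iff_nonneg)
  \<comment> \<open>Cleared of denominators, the comparison amounts to
    \<open>sin a \<le> s * C\<close>. The factor \<open>(C - sin a) * (1 - s)\<close> then turns
    both sides into squares.\<close>
  have "s \<le> s * C" using s0 C by (simp add: mult_le_cancel_left1)
  then have "(C + sin a) * (1 - s) \<le> (1 + s) * (C - sin a)" using sa by (simp add: algebra_simps)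
  then have "(C + sin a) * (C - sin a) * ((1 - s) * (1 - s)) \<le> (1 + s) * (C - sin a) * ((C - sin a) * (1 - s))"
    using mult_right_mono[of _ _ "(C - sin a) * (1 - s)"] sC s1 by (simp add: mult_ac)
  also have "\<dots> = ((cos (norm z)) * (C - sin a))\<^sup>2"
    unfolding power_mult_distrib cos_squared_eq[of "norm z"] s_def by algebra
  finally have "(norm (cos z) * (1 - s))\<^sup>2 \<le> (cos (norm z) * (C - sin a))\<^sup>2"
    by (simp only: power_mult_distrib cos_sq power2_eq_square[of "1 - s"])
  then have "norm (cos z) * (1 - s) \<le> cos (norm z) * (C - sin a)"
    by (rule power2_le_imp_le) (use c sC in simp)
  then show ?thesis
    using sC s1 by (simp add: norm_divide n1 s_def[symmetric] field_simps)
qed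

text \<open>Keeps the argument of \<open>Ln\<close> off its branch cut: cos a sinh b = 0 with cos a
  > 0 forces \<open>z\<close> to be real, and there the sine is below 1.\<close>

lemma one_minus_sin_notin_nonpos_Reals:
  fixes z :: complex
  assumes "norm z < pi / 2"
  shows "1 - sin z \<notin> \<real>\<^sub>\<le>\<^sub>0"
proof
  assume *: "1 - sin z \<in> \<real>\<^sub>\<le>\<^sub>0"
  have a: "\<bar>Re z\<bar> < pi / 2" using assms abs_Re_le_cmod[of z] by linarith
  then have "cos (Re z) > 0" by (intro cos_gt_zero_pi) auto
  moreover have "Im (sin z) = 0" "Re (sin z) \<ge> 1"
    using * by (auto simp: complex_nonpos_Reals_iff)
  ultimately have "Im z = 0" by (auto simp: Im_sin)
  then have "sin (Re z) \<ge> 1" using \<open>Re (sin z) \<ge> 1\<close> by (simp add: Re_sin)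
  moreover have "sin (Re z) < sin (pi / 2)" using a by (intro sin_monotone_2pi) linarith+
  ultimately show False by simp
qed

lemma norm_Ln_one_minus_sin_le:
  assumes z: "norm z < pi / 2"
  shows "norm (Ln (1 - sin z)) \<le> - ln (1 - sin (norm z))"
proof -
  have "norm ((- Ln (1 - sin z)) - (- Ln (1 - sin 0))) \<le> - ln (1 - sin (norm z)) - (- ln (1 - sin 0))"
  proof (rule norm_diff_le_of_deriv_majorant[OF _ _ _ z])
    show "norm (cos w / (1 - sin w)) \<le> cos (norm w) / (1 - sin (norm w))"
      if "norm w < pi / 2" for w :: complex
      using that by (rule norm_cos_div_one_minus_sin_le)
    show "((\<lambda>z. - Ln (1 - sin z)) has_field_derivative cos w / (1 - sin w)) (at w)"
      if "norm w < pi / 2" for w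
      using one_minus_sin_notin_nonpos_Reals[OF that]
      by (auto intro!: derivative_eq_intros simp: field_simps)
    show "((\<lambda>t. - ln (1 - sin t)) has_real_derivative cos t / (1 - sin t)) (at t)"
      if "0 \<le> t" "t < pi / 2" for t
    proof -
      have "sin t < 1" using sin_monotone_2pi[of t "pi / 2"] that by auto
      then show ?thesis by (auto intro!: derivative_eq_intros simp: field_simps)
    qed
  qed
  then show ?thesis by simp
qed

lemma norm_Ln_one_minus_le:
  assumes u: "norm u < 1"
  shows "norm (Ln (1 - u)) \<le> - ln (1 - norm u)"
proof -
  have "norm ((- Ln (1 - u)) - (- Ln (1 - 0))) \<le> - ln (1 - norm u) - (- ln (1 - 0))"
  proof (rule norm_diff_le_of_deriv_majorant[OF _ _ _ u])
    show "((\<lambda>u. - Ln (1 - u)) has_field_derivative 1 / (1 - w)) (at w)" if "norm w < 1" for w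
    proof -
      have "Re w < 1" using that complex_Re_le_cmod[of w] by linarith
      then have "1 - w \<notin> \<real>\<^sub>\<le>\<^sub>0" by (auto simp: complex_nonpos_Reals_iff)
      then show ?thesis by (auto intro!: derivative_eq_intros simp: field_simps)
    qed
    show "((\<lambda>t. - ln (1 - t)) has_real_derivative 1 / (1 - t)) (at t)" if "t < 1" for t :: real
      using that by (auto intro!: derivative_eq_intros simp: field_simps)
    show "norm (1 / (1 - w)) \<le> 1 / (1 - norm w)" if "norm w < 1" for w :: complex
      using norm_triangle_ineq2[of 1 w] that by (auto simp: norm_divide intro!: frac_le)
  qed
  then show ?thesis by simp
qed

section \<open>The candidate radius\<close>

text \<open>These bounds place the radius strictly between 0 and 1. For the upper one, e^x \<ge> 1 +
  x and e \<le> 3 make the exponential at least 1/3, and 2/3 < sin (pi/4) \<le> sin 1.\<close>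

lemma one_minus_phi_B_minus_one_bounds:
  "0 < 1 - exp (1 / exp 1 - 1 :: real)" "1 - exp (1 / exp 1 - 1 :: real) < sin 1"
proof -
  have e: "exp 1 > (1 :: real)" by simp
  show "0 < 1 - exp (1 / exp 1 - 1 :: real)" using e by (simp add: field_simps)
  have "exp (1 :: real) \<le> 3" using exp_le by simp
  then have "1 / 3 \<le> 1 / exp (1 :: real)" by (simp add: field_simps)
  moreover have "1 / exp 1 \<le> exp (1 / exp 1 - 1 :: real)"
    using exp_ge_add_one_self[of "1 / exp 1 - 1 :: real"] by simp
  moreover have "sin (pi / 4) \<le> sin (1 :: real)"
    using pi_less_4 pi_gt3 by (intro sin_monotone_2pi_le) auto
  moreover have "2 / 3 < sqrt 2 / 2"
  proof -
    have "4 / 3 < sqrt 2" by (rule real_less_rsqrt) (simp add: power2_eq_square)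
    then show ?thesis by simp
  qed
  ultimately show "1 - exp (1 / exp 1 - 1 :: real) < sin 1" unfolding sin_45 by linarith
qed

text \<open>The R in (0, 1) with 1 - sin R = \<open>phi_B (- 1)\<close>: there
  \<open>phi_S (- R)\<close> reaches the left end of the real values of
  \<open>phi_B\<close>.\<close>

definition sine_bean_radius :: real where
  "sine_bean_radius = arcsin (1 - exp (1 / exp 1 - 1))"

lemma sine_bean_radius:
  shows sin_sine_bean_radius: "sin sine_bean_radius = 1 - exp (1 / exp 1 - 1)"
    and sine_bean_radius_pos: "0 < sine_bean_radius"
    and sine_bean_radius_less_1: "sine_bean_radius < 1"
proof -
  note bounds = one_minus_phi_B_minus_one_bounds
  have le1: "1 - exp (1 / exp 1 - 1 :: real) \<le> 1" by simp
  show "sin sine_bean_radius = 1 - exp (1 / exp 1 - 1)"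
    unfolding sine_bean_radius_def using bounds le1 by (intro sin_arcsin) linarith+
  show "0 < sine_bean_radius"
    unfolding sine_bean_radius_def using arcsin_less_mono[of 0 "1 - exp (1 / exp 1 - 1)"] bounds(1) by simp
  have "arcsin (1 - exp (1 / exp 1 - 1)) < arcsin (sin 1)"
    using arcsin_less_mono[of "1 - exp (1 / exp 1 - 1)" "sin 1"] bounds by simp
  then show "sine_bean_radius < 1"
    unfolding sine_bean_radius_def using pi_gt3 by (simp add: arcsin_sin)
qed

section \<open>Inverting \<open>phi_B\<close> on the values of \<open>phi_S\<close>\<close>

text \<open>The constant 1 - 1/e is the majorant -ln (1 - sin t) at t = R. The majorant is applied
  at \<open>- z\<close>, since \<open>phi_S z\<close> = 1 - sin (-z).\<close>

lemma norm_Ln_phi_S_less: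
  assumes z: "norm z < sine_bean_radius"
  shows "phi_S z \<notin> \<real>\<^sub>\<le>\<^sub>0" "norm (Ln (phi_S z)) < 1 - 1 / exp 1"
proof -
  have z': "norm (- z) < pi / 2" using z sine_bean_radius_less_1 pi_gt3 by simp
  show "phi_S z \<notin> \<real>\<^sub>\<le>\<^sub>0"
    using one_minus_sin_notin_nonpos_Reals[OF z'] by (simp add: phi_S_def)
  have "sin (norm z) < sin sine_bean_radius"
    using z sine_bean_radius_less_1 pi_gt3 norm_ge_zero[of z] by (intro sin_monotone_2pi) linarith+
  then have less: "exp (1 / exp 1 - 1) < 1 - sin (norm z)"
    by (simp add: sin_sine_bean_radius)
  then have "0 < 1 - sin (norm z)" using exp_gt_zero less_trans by blast
  with less have "1 / exp 1 - 1 < ln (1 - sin (norm z))" 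
    by (metis exp_less_cancel_iff exp_ln)
  then show "norm (Ln (phi_S z)) < 1 - 1 / exp 1"
    using norm_Ln_one_minus_sin_le[OF z'] by (simp add: phi_S_def)
qed

text \<open>With u = \<open>- Ln (phi_S z)\<close>, the previous bound gives 1 - |u| > 1/e, so the
  second majorant -ln (1 - |u|) stays below 1.\<close>

lemma norm_Ln_one_plus_Ln_phi_S_less:
  assumes z: "norm z < sine_bean_radius"
  shows "norm (Ln (1 + Ln (phi_S z))) < 1"
proof -
  note less = norm_Ln_phi_S_less(2)[OF z]
  have "exp (-1) < 1 - norm (- Ln (phi_S z))"
    using less by (simp add: exp_minus inverse_eq_divide)
  then have "-1 < ln (1 - norm (- Ln (phi_S z)))"
    by (metis exp_gt_zero exp_less_cancel_iff exp_ln less_trans)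
  moreover have "norm (- Ln (phi_S z)) < 1" using less by (simp add: less_trans)
  ultimately show ?thesis using norm_Ln_one_minus_le[of "- Ln (phi_S z)"] by simp
qed

lemma one_plus_Ln_phi_S_notin_nonpos_Reals:
  assumes z: "norm z < sine_bean_radius"
  shows "1 + Ln (phi_S z) \<notin> \<real>\<^sub>\<le>\<^sub>0"
proof -
  have "norm (Ln (phi_S z)) < 1"
    using norm_Ln_phi_S_less(2)[OF z] by (simp add: less_trans)
  then have "0 < Re (1 + Ln (phi_S z))" using abs_Re_le_cmod[of "Ln (phi_S z)"] by simp
  then show ?thesis by (auto simp: complex_nonpos_Reals_iff)
qed

text \<open>\<open>exp w - 1\<close> is a logarithm of \<open>c\<close>, and |Im (exp w)| < e < 2 pi
  singles out the real one. So \<open>exp w\<close> = 1 + ln c is real and positive, hence equal to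
  its modulus, which exceeds 1/e.\<close>

lemma phi_B_real_ge:
  assumes w: "norm w < 1" and eq: "phi_B w = of_real c" and c: "0 < c"
  shows "exp (1 / exp 1 - 1) \<le> c"
proof -
  define E where "E = exp w"
  have "\<bar>Re w\<bar> < 1" using w abs_Re_le_cmod[of w] by linarith
  then have "exp (- 1) < norm E" "norm E < exp 1" by (auto simp: E_def)
  then have E_norm: "1 / exp 1 < norm E" "norm E < exp 1"
    by (simp_all add: exp_minus inverse_eq_divide)
  \<comment> \<open>Needed to exclude \<open>E = - norm E\<close> once \<open>E\<close> is known to
    be real.\<close>
  have "Re E > 0"
  proof -
    have "\<bar>Im w\<bar> < pi / 2" using w abs_Im_le_cmod[of w] pi_gt3 by linarith
    then show ?thesis unfolding E_def Re_exp by (intro mult_pos_pos cos_gt_zero_pi) auto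
  qed
  have "exp (E - 1) = exp (of_real (ln c))"
    using eq c by (simp add: phi_B_def E_def exp_of_real)
  then obtain n :: int where n: "E - 1 = of_real (ln c) + (of_int (2 * n) * pi) * \<i>"
    by (auto simp: exp_eq)
  have "\<bar>Im E\<bar> < 3" using E_norm abs_Im_le_cmod[of E] exp_le by linarith
  moreover have ImE: "Im E = of_int (2 * n) * pi" using arg_cong[OF n, of Im] by simp
  ultimately have "\<bar>real_of_int n\<bar> * (2 * pi) < 3" by (simp add: abs_mult)
  moreover have "\<bar>real_of_int n\<bar> \<ge> 1" if "n \<noteq> 0" using that by linarith
  ultimately have "n = 0" using pi_gt3 mult_right_mono[of 1 "\<bar>real_of_int n\<bar>" "2 * pi"] by fastforce
  then have "Im E = 0" using ImE by simp
  then have "norm E = Re E" using \<open>Re E > 0\<close> by (simp add: cmod_def)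
  moreover have "Re E = 1 + ln c" using arg_cong[OF n, of Re] by simp
  ultimately have "1 / exp 1 - 1 < ln c" using E_norm(1) by simp
  then show ?thesis using c by (metis exp_less_cancel_iff exp_ln less_imp_le)
qed

section \<open>Dilations and the extremal function\<close>

lemma deriv_dilation:
  assumes f: "f holomorphic_on unit_disc" and r: "0 < r" "r \<le> 1" and z: "z \<in> unit_disc"
  shows "(dilation r f has_field_derivative deriv f (of_real r * z)) (at z)"
proof -
  have "norm (of_real r * z) < 1" using r z mult_le_less_imp_less[of r 1 "norm z" 1]
    by (auto simp: norm_mult intro: le_less_trans[OF mult_left_le_one_le])
  then have "(f has_field_derivative deriv f (of_real r * z)) (at (of_real r * z))"
    using f by (intro holomorphic_derivI[of f unit_disc]) auto
  then show ?thesis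
    unfolding dilation_def using r
    by (auto intro!: derivative_eq_intros DERIV_chain2[where f = f])
qed

lemma log_deriv_quotient_dilation:
  assumes "f holomorphic_on unit_disc" "0 < r" "r \<le> 1" "z \<in> unit_disc"
  shows "log_deriv_quotient (dilation r f) z = log_deriv_quotient f (of_real r * z)"
  using DERIV_imp_deriv[OF deriv_dilation[OF assms]] assms(2)
  by (auto simp: log_deriv_quotient_def dilation_def)

text \<open>Normalization and absence of zeros pass to the dilation because
  \<open>of_real r * z\<close> stays in the disc, so only the subordination remains to be
  tested.\<close>

lemma dilation_in_starlike_class_iff:
  assumes f: "f \<in> starlike_class \<phi>" and r: "0 < r" "r \<le> 1"
  shows "dilation r f \<in> starlike_class \<psi> \<longleftrightarrow>
    subordinate (\<lambda>z. log_deriv_quotient f (of_real r * z)) \<psi>"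
proof -
  have hol: "f holomorphic_on unit_disc" and f0: "f 0 = 0" "deriv f 0 = 1"
    and nz: "\<And>z. z \<in> unit_disc - {0} \<Longrightarrow> f z \<noteq> 0"
    using f by (auto simp: starlike_class_def normalized_analytic_def)
  have "dilation r f holomorphic_on unit_disc"
    using deriv_dilation[OF hol r] by (meson holomorphic_on_open open_ball)
  moreover have "deriv (dilation r f) 0 = 1"
    using DERIV_imp_deriv[OF deriv_dilation[OF hol r, of 0]] f0 by simp
  moreover have "dilation r f z \<noteq> 0" if "z \<in> unit_disc - {0}" for z
  proof -
    have "of_real r * z \<in> unit_disc - {0}"
      using that r by (auto simp: norm_mult intro: le_less_trans[OF mult_left_le_one_le])
    then show ?thesis using nz r by (simp add: dilation_def)
  qed
  moreover have "subordinate (log_deriv_quotient (dilation r f)) \<psi> \<longleftrightarrow>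
    subordinate (\<lambda>z. log_deriv_quotient f (of_real r * z)) \<psi>"
    unfolding subordinate_def using log_deriv_quotient_dilation[OF hol r] by simp
  ultimately show ?thesis
    using f0 by (auto simp: starlike_class_def normalized_analytic_def dilation_def)
qed

text \<open>The solution is f(z) = z exp of the integral of (\<phi>(t) - 1) / t from 0 to z. Its
  Schwarz function is the identity.\<close>

lemma exists_log_deriv_quotient_eq:
  assumes \<phi>: "\<phi> holomorphic_on unit_disc" "\<phi> 0 = 1"
  obtains f where "f \<in> starlike_class \<phi>" "\<And>z. z \<in> unit_disc \<Longrightarrow> log_deriv_quotient f z = \<phi> z"
proof -
  \<comment> \<open>The value at 0 fills the removable singularity, so that \<open>q\<close> has a
    primitive on the disc.\<close>
  define q where "q = (\<lambda>z. if z = 0 then deriv \<phi> 0 else (\<phi> z - \<phi> 0) / (z - 0))"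
  have "q holomorphic_on unit_disc"
    unfolding q_def by (rule pole_lemma_open) (use \<phi> in auto)
  then obtain Q where Q: "\<And>z. z \<in> unit_disc \<Longrightarrow> (Q has_field_derivative q z) (at z within unit_disc)"
    using holomorphic_convex_primitive'[of unit_disc q] by auto
  define f where "f = (\<lambda>z. z * exp (Q z - Q 0))"
  have f_deriv: "(f has_field_derivative \<phi> z * exp (Q z - Q 0)) (at z)" if "z \<in> unit_disc" for z
  proof -
    have "(Q has_field_derivative q z) (at z)"
      using Q[OF that] that by (simp add: at_within_open[of z unit_disc])
    then have "(f has_field_derivative (1 + z * q z) * exp (Q z - Q 0)) (at z)"
      unfolding f_def by (auto intro!: derivative_eq_intros simp: algebra_simps)
    moreover have "1 + z * q z = \<phi> z" using \<phi> by (simp add: q_def)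
    ultimately show ?thesis by simp
  qed
  have "f holomorphic_on unit_disc"
    using f_deriv by (meson holomorphic_on_open open_ball)
  moreover have "deriv f 0 = 1" using DERIV_imp_deriv[OF f_deriv[of 0]] \<phi> by simp
  moreover have quot: "log_deriv_quotient f z = \<phi> z" if "z \<in> unit_disc" for z
    using DERIV_imp_deriv[OF f_deriv[OF that]] \<phi> by (simp add: log_deriv_quotient_def f_def)
  moreover have "subordinate (log_deriv_quotient f) \<phi>"
    unfolding subordinate_def by (rule exI[of _ "\<lambda>z. z"]) (use quot in auto)
  ultimately have "f \<in> starlike_class \<phi>"
    by (auto simp: starlike_class_def normalized_analytic_def f_def)
  with quot show ?thesis using that by blast
qed

section \<open>The radius works, and no larger one does\<close>

lemma dilation_in_starlike_class_phi_B:
  assumes f: "f \<in> starlike_class phi_S" and r: "0 < r" "r \<le> sine_bean_radius"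
  shows "dilation r f \<in> starlike_class phi_B"
proof -
  have r1: "r \<le> 1" using r sine_bean_radius_less_1 by linarith
  obtain \<omega> where hol: "\<omega> holomorphic_on unit_disc" and into: "\<omega> ` unit_disc \<subseteq> unit_disc"
    and \<omega>0: "\<omega> 0 = 0" and eq: "\<And>z. z \<in> unit_disc \<Longrightarrow> log_deriv_quotient f z = phi_S (\<omega> z)"
    using f by (auto simp: starlike_class_def subordinate_def)
  have in_disc: "norm (of_real r * z) < 1" if "norm z < 1" for z :: complex
    using that r r1 by (auto simp: norm_mult intro: le_less_trans[OF mult_left_le_one_le])
  have small: "norm (\<omega> (of_real r * z)) < sine_bean_radius" if "norm z < 1" for z
  proof -
    \<comment> \<open>The Schwarz lemma brings an arbitrary member of the class into the disc of
      radius R. The strict bound below persists for r = R.\<close>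
    have "norm (\<omega> (of_real r * z)) \<le> norm (of_real r * z)"
      by (rule Schwarz_Lemma(1)[OF hol \<omega>0 _ in_disc[OF that]]) (use into in \<open>simp add: image_subset_iff\<close>)
    also have "\<dots> < r" using that r by (simp add: norm_mult)
    finally show ?thesis using r by simp
  qed
  \<comment> \<open>\<open>v\<close> solves \<open>phi_B (v z)\<close> =
    \<open>phi_S (\<omega> (of_real r * z))\<close> by principal logarithms, which also give
    \<open>v 0 = 0\<close>.\<close>
  define v where "v = (\<lambda>z. Ln (1 + Ln (phi_S (\<omega> (of_real r * z)))))"
  have hol': "(\<lambda>z. \<omega> (of_real r * z)) holomorphic_on unit_disc"
    by (rule holomorphic_on_compose_gen[OF _ hol, unfolded o_def])
      (use in_disc in \<open>auto intro!: holomorphic_intros\<close>)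
  have phi_S_hol: "(\<lambda>z. phi_S (\<omega> (of_real r * z))) holomorphic_on unit_disc"
    unfolding phi_S_def by (intro holomorphic_intros hol')
  have "subordinate (\<lambda>z. log_deriv_quotient f (of_real r * z)) phi_B"
    unfolding subordinate_def
  proof (intro exI[of _ v] conjI ballI)
    show "v holomorphic_on unit_disc"
      unfolding v_def
      by (intro holomorphic_intros phi_S_hol)
        (use small norm_Ln_phi_S_less(1) one_plus_Ln_phi_S_notin_nonpos_Reals in auto)
    show "v ` unit_disc \<subseteq> unit_disc"
      using small norm_Ln_one_plus_Ln_phi_S_less by (auto simp: v_def)
    show "v 0 = 0" by (simp add: v_def \<omega>0 phi_S_def)
    show "log_deriv_quotient f (of_real r * z) = phi_B (v z)" if "z \<in> unit_disc" for z
    proof -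
      have z: "norm z < 1" using that by simp
      have "1 + Ln (phi_S (\<omega> (of_real r * z))) \<noteq> 0" "phi_S (\<omega> (of_real r * z)) \<noteq> 0"
        using norm_Ln_phi_S_less(1)[OF small[OF z]]
          one_plus_Ln_phi_S_notin_nonpos_Reals[OF small[OF z]] by auto
      then show ?thesis using eq in_disc[OF z] by (simp add: phi_B_def v_def)
    qed
  qed
  then show ?thesis using dilation_in_starlike_class_iff[OF f r(1) r1] by simp
qed

lemma radius_le_sine_bean_radius:
  assumes r: "0 < r" "r \<le> 1" and all: "\<forall>f\<in>starlike_class phi_S. dilation r f \<in> starlike_class phi_B"
  shows "r \<le> sine_bean_radius"
proof (rule ccontr)
  assume "\<not> r \<le> sine_bean_radius"
  \<comment> \<open>Choosing \<open>x\<close> strictly below \<open>r\<close> puts the test point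
    \<open>- x / r\<close> inside the open disc. The dilation carries it to \<open>- x\<close>,
    where \<open>phi_S\<close> has the value 1 - sin x < \<open>phi_B (- 1)\<close>.\<close>
  then obtain x where x: "sine_bean_radius < x" "x < r" using dense[of sine_bean_radius r] by auto
  then have x01: "0 < x" "x < 1" using r sine_bean_radius_pos by auto
  have "phi_S holomorphic_on unit_disc" "phi_S 0 = 1"
    unfolding phi_S_def by (auto intro!: holomorphic_intros)
  then obtain f where f: "f \<in> starlike_class phi_S"
    and quot: "\<And>z. z \<in> unit_disc \<Longrightarrow> log_deriv_quotient f z = phi_S z"
    using exists_log_deriv_quotient_eq by blast
  then have "subordinate (\<lambda>z. log_deriv_quotient f (of_real r * z)) phi_B"
    using all dilation_in_starlike_class_iff[OF f r] by blast
  then obtain w where into: "w ` unit_disc \<subseteq> unit_disc"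
    and eq: "\<And>z. z \<in> unit_disc \<Longrightarrow> log_deriv_quotient f (of_real r * z) = phi_B (w z)"
    by (auto simp: subordinate_def)
  define z where "z = (of_real (- x / r) :: complex)"
  have z: "z \<in> unit_disc" "of_real r * z = of_real (- x)"
    using x x01 r by (auto simp: z_def norm_divide)
  have "phi_B (w z) = phi_S (of_real (- x))"
    using eq[OF z(1)] quot[of "of_real (- x)"] x01 by (simp add: z(2))
  also have "\<dots> = of_real (1 - sin x)" by (simp add: phi_S_def sin_of_real)
  finally have "exp (1 / exp 1 - 1) \<le> 1 - sin x"
  proof (rule phi_B_real_ge[rotated])
    show "norm (w z) < 1" using into z by (simp add: image_subset_iff)
    show "0 < 1 - sin x" using sin_monotone_2pi[of x "pi / 2"] x01 pi_gt3 by simp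
  qed
  moreover have "sin sine_bean_radius < sin x"
    using x x01 sine_bean_radius_pos pi_gt3 by (intro sin_monotone_2pi) auto
  ultimately show False by (simp add: sin_sine_bean_radius)
qed

theorem theorem7p8:
  shows "starlike_radius phi_B phi_S = arcsin (1 - exp (1 / exp 1 - 1))"
proof -
  \<comment> \<open>The supremum is attained: R itself is admissible.\<close>
  have "Sup {r \<in> {0<..1}. \<forall>f\<in>starlike_class phi_S. dilation r f \<in> starlike_class phi_B}
    = sine_bean_radius"
    by (rule cSup_eq_maximum)
      (use sine_bean_radius_pos sine_bean_radius_less_1 in
        \<open>auto intro: dilation_in_starlike_class_phi_B radius_le_sine_bean_radius\<close>)
  then show ?thesis by (simp add: starlike_radius_def sine_bean_radius_def)
qed

end
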